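(* Let $D$ be an integrally closed domain with quotient field $K$ and let $n\geq 1$. For each $\Omega\subset\Lambda_n$ of cardinality at most $n$, choose $M\in M_n(D)'$ such that $\Omega_M=\Omega$. Let $S$ be the set formed by such matrices. Then $S$ is polynomially dense in $M_n(D)'$. In particular, the set of companion matrices in $M_n(D)$ is polynomially dense in $M_n(D)'$.
   Context: $\overline{K}$ is a fixed algebraic closure of $K$. A matrix $M\in M_n(K)$ is integral (over $D$) if it is a root of a monic polynomial in $D[X]$; $M_n(D)'$ is the set of all matrices in $M_n(K)$ that are integral over $D$. For $M\in M_n(K)$, $\Omega_M$ is the set of eigenvalues of $M$ in $\overline{K}$. $\Lambda_n=\{\alpha\in\overline{K}\mid\alpha\text{ is a root of a monic polynomial in }D[X]\text{ of degree }n\}$. The companion matrices in $M_n(D)$ are the companion matrices of monic polynomials of degree $n$ in $D[X]$. For $S\subseteq T\subseteq M_n(K)$, let $\mathrm{Int}_K(S,T)=\{f\in K[X]\mid f(S)\subseteq T\}$ and $\mathrm{Int}_K(T)=\mathrm{Int}_K(T,T)$; $S$ is polynomially dense in $T$ if $\mathrm{Int}_K(S,T)=\mathrm{Int}_K(T)$.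
   Formalization: A matrix M is chosen only for those Ω ⊂ Λ_n of cardinality at most n for which some M in M_n(D)' has Ω_M = Ω; for other Ω (the empty set, or {√2} over the integers) no such M exists, so the choice as stated is impossible. *)

theory Defs
  imports
    "HOL-Computational_Algebra.Polynomial_Factorial"
    "HOL-Algebra.Algebraic_Closure_Type"
    "Jordan_Normal_Form.Spectral_Radius"
begin

text \<open>
  The domain \<open>D\<close> is a type \<open>'d :: idom\<close>, its quotient field \<open>K\<close> is \<open>'d fract\<close> (with embedding
  \<open>to_fract\<close>), and the fixed algebraic closure of \<open>K\<close> is \<open>'d fract alg_closure\<close> (with embedding
  \<open>to_ac\<close>). Elements of \<open>M_n(K)\<close> are the elements of \<open>carrier_mat n n\<close>.
\<close>

definition integral_elem :: "'d::idom fract \<Rightarrow> bool" where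
  "integral_elem x \<longleftrightarrow>
     (\<exists>p :: 'd poly. lead_coeff p = 1 \<and> poly (map_poly to_fract p) x = 0)"

definition integrally_closed :: "'d::idom itself \<Rightarrow> bool" where
  "integrally_closed _ \<longleftrightarrow> (\<forall>x :: 'd fract. integral_elem x \<longrightarrow> x \<in> range to_fract)"

text \<open>
  The value \<open>f(M)\<close>, i.e. the sum of the matrices \<open>coeff f k \<cdot>\<^sub>m M ^\<^sub>m k\<close>, written entrywise since
  matrices of varying dimension do not form a type-class monoid. It is meant for square \<open>M\<close>.
\<close>

definition poly_at_mat :: "'a::comm_ring_1 poly \<Rightarrow> 'a mat \<Rightarrow> 'a mat" where
  "poly_at_mat f M = mat (dim_row M) (dim_row M)
     (\<lambda>(i, j). \<Sum>k\<le>Polynomial.degree f. poly.coeff f k * (M ^\<^sub>m k) $$ (i, j))"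

text \<open>The set \<open>M_n(D)'\<close>.\<close>

definition integral_mats :: "nat \<Rightarrow> 'd::idom fract mat set" where
  "integral_mats n = {M \<in> carrier_mat n n.
     \<exists>p :: 'd poly. lead_coeff p = 1 \<and> poly_at_mat (map_poly to_fract p) M = 0\<^sub>m n n}"

text \<open>The set \<open>\<Omega>_M\<close>.\<close>

definition eigenvalues_ac :: "'k::field mat \<Rightarrow> 'k alg_closure set" where
  "eigenvalues_ac M = spectrum (map_mat to_ac M)"

text \<open>The set \<open>\<Lambda>_n\<close>.\<close>

definition integral_roots :: "nat \<Rightarrow> 'd::idom fract alg_closure set" where
  "integral_roots n = {\<alpha>. \<exists>p :: 'd poly. lead_coeff p = 1 \<and> Polynomial.degree p = n \<and>
     poly (map_poly (\<lambda>c. to_ac (to_fract c)) p) \<alpha> = 0}"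

definition companion_mat :: "'a::comm_ring_1 poly \<Rightarrow> 'a mat" where
  "companion_mat p = (let n = Polynomial.degree p in mat n n
     (\<lambda>(i, j). if j = n - 1 then - poly.coeff p i else if i = Suc j then 1 else 0))"

definition companion_mats :: "nat \<Rightarrow> 'd::idom fract mat set" where
  "companion_mats n = {map_mat to_fract (companion_mat p) | p :: 'd poly.
     lead_coeff p = 1 \<and> Polynomial.degree p = n}"

definition Int_K :: "'k::field mat set \<Rightarrow> 'k mat set \<Rightarrow> 'k poly set" where
  "Int_K S T = {f. \<forall>M\<in>S. poly_at_mat f M \<in> T}"

definition polynomially_dense :: "'k::field mat set \<Rightarrow> 'k mat set \<Rightarrow> bool" where
  "polynomially_dense S T \<longleftrightarrow> S \<subseteq> T \<and> Int_K S T = Int_K T T"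

text \<open>
  The sets \<open>\<Omega>\<close> for which a matrix is to be chosen. Not every subset of \<open>\<Lambda>_n\<close> with at most \<open>n\<close>
  elements is the eigenvalue set of a matrix over \<open>K\<close> (it must be nonempty and the set of roots of a
  polynomial over \<open>K\<close>), so only those for which a choice is possible are considered.
\<close>

definition realizable_spectra :: "nat \<Rightarrow> 'd::idom fract alg_closure set set" where
  "realizable_spectra n = {\<Omega>. \<Omega> \<subseteq> integral_roots n \<and> finite \<Omega> \<and> card \<Omega> \<le> n \<and>
     (\<exists>M\<in>integral_mats n. eigenvalues_ac M = \<Omega>)}"

end

theory Submission
  imports Defs
begin

text \<open>
  For \<open>M \<in> M_n(K)\<close> and \<open>f \<in> K[X]\<close>, the matrix \<open>f(M)\<close> is integral over \<open>D\<close> if and only if \<open>f(\<alpha>)\<close> is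
  integral over \<open>D\<close> for every eigenvalue \<open>\<alpha>\<close> of \<open>M\<close>. Hence a set \<open>S\<close> of integral matrices is
  polynomially dense as soon as the spectrum of every integral matrix is contained in the spectrum
  of a member of \<open>S\<close>. The coefficients of the characteristic polynomial of an integral matrix lie
  in \<open>K\<close> and are integral, being polynomials in the eigenvalues. So they lie in \<open>D\<close>, whence the
  spectrum is one of the admissible sets \<open>\<Omega>\<close>, and it is the root set of a polynomial that has a
  companion matrix in \<open>M_n(D)\<close>.
\<close>

section \<open>Polynomials evaluated at matrices\<close>

lemma index_mult_mat_sum:
  assumes "A \<in> carrier_mat n m" "B \<in> carrier_mat m l" "i < n" "j < l"
  shows "(A * B) $$ (i, j) = (\<Sum>r<m. A $$ (i, r) * B $$ (r, j))"
  using assms by (auto simp: scalar_prod_def lessThan_atLeast0 intro!: sum.cong)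

lemma poly_at_mat_carrier [simp]:
  "A \<in> carrier_mat n n \<Longrightarrow> poly_at_mat f A \<in> carrier_mat n n"
  by (auto simp: poly_at_mat_def)

lemma dim_poly_at_mat [simp]:
  "dim_row (poly_at_mat f A) = dim_row A" "dim_col (poly_at_mat f A) = dim_row A"
  by (auto simp: poly_at_mat_def)

lemma poly_at_mat_index:
  assumes "A \<in> carrier_mat n n" "i < n" "j < n" "Polynomial.degree f \<le> N"
  shows "poly_at_mat f A $$ (i, j) = (\<Sum>k\<le>N. poly.coeff f k * (A ^\<^sub>m k) $$ (i, j))"
proof -
  have "(\<Sum>k\<le>Polynomial.degree f. poly.coeff f k * (A ^\<^sub>m k) $$ (i, j)) =
      (\<Sum>k\<le>N. poly.coeff f k * (A ^\<^sub>m k) $$ (i, j))"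
    using assms(4) by (intro sum.mono_neutral_left) (auto simp: coeff_eq_0)
  then show ?thesis
    using assms by (simp add: poly_at_mat_def)
qed

lemma poly_at_mat_0 [simp]: "A \<in> carrier_mat n n \<Longrightarrow> poly_at_mat 0 A = 0\<^sub>m n n"
  by (auto simp: poly_at_mat_def)

text \<open>Horner's scheme: it replaces the entrywise sum by a recursion, on which the inductions
  for products, composition and eigenvectors rest.\<close>

lemma poly_at_mat_pCons:
  assumes A: "A \<in> carrier_mat n n"
  shows "poly_at_mat (pCons a p) A = a \<cdot>\<^sub>m 1\<^sub>m n + poly_at_mat p A * A"
proof (rule eq_matI)
  fix i j assume "i < dim_row (a \<cdot>\<^sub>m 1\<^sub>m n + poly_at_mat p A * A)"
    "j < dim_col (a \<cdot>\<^sub>m 1\<^sub>m n + poly_at_mat p A * A)"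
  then have ij: "i < n" "j < n" using A by auto
  let ?d = "Polynomial.degree p"
  have step: "(A ^\<^sub>m Suc k) $$ (i, j) = (\<Sum>l<n. (A ^\<^sub>m k) $$ (i, l) * A $$ (l, j))" for k
    using A ij by (simp add: index_mult_mat_sum[of _ n n _ n] del: index_mult_mat)
  have "poly_at_mat (pCons a p) A $$ (i, j) =
      (\<Sum>k\<le>Suc ?d. poly.coeff (pCons a p) k * (A ^\<^sub>m k) $$ (i, j))"
    using A ij by (intro poly_at_mat_index) (auto simp: degree_pCons_le)
  also have "\<dots> = a * 1\<^sub>m n $$ (i, j) + (\<Sum>k\<le>?d. poly.coeff p k * (A ^\<^sub>m Suc k) $$ (i, j))"
    using A by (subst sum.atMost_Suc_shift) simp
  also have "(\<Sum>k\<le>?d. poly.coeff p k * (A ^\<^sub>m Suc k) $$ (i, j)) =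
      (\<Sum>k\<le>?d. \<Sum>l<n. poly.coeff p k * (A ^\<^sub>m k) $$ (i, l) * A $$ (l, j))"
    unfolding step by (simp add: sum_distrib_left mult.assoc)
  also have "\<dots> = (\<Sum>l<n. poly_at_mat p A $$ (i, l) * A $$ (l, j))"
    by (subst sum.swap)
      (intro sum.cong refl, use A ij in \<open>simp add: poly_at_mat_index[OF A _ _ order.refl] sum_distrib_right\<close>)
  also have "\<dots> = (poly_at_mat p A * A) $$ (i, j)"
    using A ij by (simp add: index_mult_mat_sum[of _ n n _ n] del: index_mult_mat)
  finally show "poly_at_mat (pCons a p) A $$ (i, j) = (a \<cdot>\<^sub>m 1\<^sub>m n + poly_at_mat p A * A) $$ (i, j)"
    using A ij poly_at_mat_carrier[OF A, of p] by simp
qed (use A in \<open>auto simp: poly_at_mat_def\<close>)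

lemma poly_at_mat_const:
  assumes "A \<in> carrier_mat n n"
  shows "poly_at_mat [:a:] A = a \<cdot>\<^sub>m 1\<^sub>m n"
  using assms by (subst poly_at_mat_pCons[OF assms]) simp

lemma zero_smult_one_mat: "(0 :: 'a :: comm_ring_1) \<cdot>\<^sub>m 1\<^sub>m n = 0\<^sub>m n n"
  by (rule eq_matI) auto

lemma poly_at_mat_add:
  assumes A: "A \<in> carrier_mat n n"
  shows "poly_at_mat (p + q) A = poly_at_mat p A + poly_at_mat q A"
proof (rule eq_matI)
  fix i j assume "i < dim_row (poly_at_mat p A + poly_at_mat q A)"
    "j < dim_col (poly_at_mat p A + poly_at_mat q A)"
  then have ij: "i < n" "j < n" using A by (auto simp: poly_at_mat_def)
  define N where "N = max (Polynomial.degree p) (Polynomial.degree q)"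
  have "Polynomial.degree (p + q) \<le> N" "Polynomial.degree p \<le> N" "Polynomial.degree q \<le> N"
    unfolding N_def by (auto simp: degree_add_le_max)
  then show "poly_at_mat (p + q) A $$ (i, j) = (poly_at_mat p A + poly_at_mat q A) $$ (i, j)"
    using A ij poly_at_mat_carrier[OF A, of p] poly_at_mat_carrier[OF A, of q]
    by (simp add: poly_at_mat_index[OF A ij] sum.distrib distrib_right)
qed (use A in \<open>auto simp: poly_at_mat_def\<close>)

lemma poly_at_mat_smult:
  assumes A: "A \<in> carrier_mat n n"
  shows "poly_at_mat (Polynomial.smult a p) A = a \<cdot>\<^sub>m poly_at_mat p A"
proof (rule eq_matI)
  fix i j assume "i < dim_row (a \<cdot>\<^sub>m poly_at_mat p A)" "j < dim_col (a \<cdot>\<^sub>m poly_at_mat p A)"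
  then have ij: "i < n" "j < n" using A by (auto simp: poly_at_mat_def)
  show "poly_at_mat (Polynomial.smult a p) A $$ (i, j) = (a \<cdot>\<^sub>m poly_at_mat p A) $$ (i, j)"
    using A ij poly_at_mat_carrier[OF A, of p]
    by (simp add: poly_at_mat_index[OF A ij, of _ "Polynomial.degree p"] degree_smult_le
        sum_distrib_left mult.assoc)
qed (use A in \<open>auto simp: poly_at_mat_def\<close>)

text \<open>With this order of the factors the induction needs no commutation of powers of \<open>A\<close>.\<close>

lemma poly_at_mat_mult:
  assumes A: "A \<in> carrier_mat n n"
  shows "poly_at_mat (p * q) A = poly_at_mat q A * poly_at_mat p A"
proof (induction p)
  case 0
  then show ?case using A by (simp add: right_mult_zero_mat[OF poly_at_mat_carrier[OF A]])
next
  case (pCons a p)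
  let ?P = "poly_at_mat p A" and ?Q = "poly_at_mat q A"
  have P: "?P \<in> carrier_mat n n" and Q: "?Q \<in> carrier_mat n n" using A by auto
  have "poly_at_mat (pCons a p * q) A = a \<cdot>\<^sub>m ?Q + (0 \<cdot>\<^sub>m 1\<^sub>m n + (?Q * ?P) * A)"
    by (simp add: poly_at_mat_add[OF A] poly_at_mat_smult[OF A] poly_at_mat_pCons[OF A] pCons.IH)
  also have "0 \<cdot>\<^sub>m 1\<^sub>m n + (?Q * ?P) * A = ?Q * (?P * A)"
    using A P Q mult_carrier_mat[OF Q mult_carrier_mat[OF P A]]
    by (simp add: zero_smult_one_mat assoc_mult_mat[of _ n n _ n _ n])
  also have "a \<cdot>\<^sub>m ?Q = ?Q * (a \<cdot>\<^sub>m 1\<^sub>m n)"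
    using Q by (simp add: mult_smult_distrib[of _ n n _ n] right_mult_one_mat[OF Q])
  also have "?Q * (a \<cdot>\<^sub>m 1\<^sub>m n) + ?Q * (?P * A) = ?Q * (a \<cdot>\<^sub>m 1\<^sub>m n + ?P * A)"
    using A P Q by (intro mult_add_distrib_mat[symmetric, of _ n n _ n]) auto
  finally show ?case by (simp add: poly_at_mat_pCons[OF A])
qed

text \<open>Turns the annihilation of \<open>A\<close> by a composite \<open>p o q\<close> into the
  annihilation of \<open>q(A)\<close> by \<open>p\<close>.\<close>

lemma poly_at_mat_pcompose:
  assumes A: "A \<in> carrier_mat n n"
  shows "poly_at_mat (pcompose p q) A = poly_at_mat p (poly_at_mat q A)"
proof (induction p)
  case 0
  then show ?case using A by (simp add: poly_at_mat_0[OF poly_at_mat_carrier[OF A]])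
next
  case (pCons a p)
  then show ?case
    using A by (simp add: pcompose_pCons poly_at_mat_add[OF A] poly_at_mat_mult[OF A]
        poly_at_mat_const[OF A] poly_at_mat_pCons[OF poly_at_mat_carrier[OF A]])
qed

lemma poly_at_mat_dvd_eq_0:
  assumes A: "A \<in> carrier_mat n n" and "poly_at_mat p A = 0\<^sub>m n n" "p dvd q"
  shows "poly_at_mat q A = 0\<^sub>m n n"
  using assms(2,3)
  by (auto elim!: dvdE simp: poly_at_mat_mult[OF A] right_mult_zero_mat[OF poly_at_mat_carrier[OF A]])

text \<open>Lets computations pass from \<open>K\<close> to its algebraic closure, where the
  eigenvalues live and characteristic polynomials split.\<close>

lemma (in comm_ring_hom) poly_at_mat_hom:
  assumes A: "A \<in> carrier_mat n n"
  shows "map_mat hom (poly_at_mat p A) = poly_at_mat (map_poly hom p) (map_mat hom A)"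
proof (rule eq_matI)
  fix i j assume "i < dim_row (poly_at_mat (map_poly hom p) (map_mat hom A))"
    "j < dim_col (poly_at_mat (map_poly hom p) (map_mat hom A))"
  then have ij: "i < n" "j < n" using A by (auto simp: poly_at_mat_def)
  have A': "map_mat hom A \<in> carrier_mat n n" using A by simp
  have pow: "(map_mat hom A ^\<^sub>m k) $$ (i, j) = hom ((A ^\<^sub>m k) $$ (i, j))" for k
    using A ij by (simp flip: mat_hom_pow[OF A])
  show "map_mat hom (poly_at_mat p A) $$ (i, j) =
      poly_at_mat (map_poly hom p) (map_mat hom A) $$ (i, j)"
    using A ij poly_at_mat_carrier[OF A, of p]
    by (simp add: poly_at_mat_index[OF A ij order.refl] pow hom_sum hom_mult
      poly_at_mat_index[OF A' ij degree_map_poly_le])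
qed (use A in \<open>auto simp: poly_at_mat_def\<close>)

section \<open>Eigenvectors of polynomial values and the Cayley-Hamilton theorem\<close>

lemma eigenvector_poly_at_mat:
  fixes A :: "'a :: field mat"
  assumes A: "A \<in> carrier_mat n n" and ev: "eigenvector A v k"
  shows "poly_at_mat p A *\<^sub>v v = poly p k \<cdot>\<^sub>v v"
proof (induction p)
  case 0
  then show ?case using A ev by (auto simp: eigenvector_def)
next
  case (pCons a p)
  have v: "v \<in> carrier_vec n" and Av: "A *\<^sub>v v = k \<cdot>\<^sub>v v"
    using A ev by (auto simp: eigenvector_def)
  have P: "poly_at_mat p A \<in> carrier_mat n n" using A by simp
  have "poly_at_mat (pCons a p) A *\<^sub>v v = (a \<cdot>\<^sub>m 1\<^sub>m n) *\<^sub>v v + (poly_at_mat p A * A) *\<^sub>v v"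
    unfolding poly_at_mat_pCons[OF A] using A P v by (intro add_mult_distrib_mat_vec[of _ n n]) auto
  also have "(poly_at_mat p A * A) *\<^sub>v v = k \<cdot>\<^sub>v (poly_at_mat p A *\<^sub>v v)"
    using A P v by (simp add: assoc_mult_mat_vec[of _ n n _ n] Av mult_mat_vec[of _ n n])
  also have "(a \<cdot>\<^sub>m 1\<^sub>m n) *\<^sub>v v = a \<cdot>\<^sub>v v"
    using v by (intro eq_vecI) (auto simp: row_smult scalar_prod_left_unit)
  finally show ?case
    using v by (simp add: pCons.IH smult_smult_assoc add_smult_distrib_vec)
qed

lemma eigenvector_poly_at_mat':
  fixes A :: "'a :: field mat"
  assumes "A \<in> carrier_mat n n" and "eigenvector A v k"
  shows "eigenvector (poly_at_mat p A) v (poly p k)"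
  using assms(2) eigenvector_poly_at_mat[OF assms] assms(1)
    poly_at_mat_carrier[OF assms(1), of p]
  by (auto simp: eigenvector_def)

lemma poly_at_mat_0_eigenvector:
  fixes A :: "'a :: field mat"
  assumes A: "A \<in> carrier_mat n n" and ev: "eigenvector A v k"
    and 0: "poly_at_mat p A = 0\<^sub>m n n"
  shows "poly p k = 0"
proof -
  have v: "v \<in> carrier_vec n" "v \<noteq> 0\<^sub>v n"
    using A ev by (auto simp: eigenvector_def)
  then obtain i where i: "i < n" "v $ i \<noteq> 0" by force
  have "poly p k \<cdot>\<^sub>v v = 0\<^sub>v n"
    using v by (auto simp flip: eigenvector_poly_at_mat[OF A ev] simp: 0)
  then have "(poly p k \<cdot>\<^sub>v v) $ i = 0" using i by simp
  then show ?thesis using i v by simp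
qed

text \<open>
  Comparing coefficients in \<open>(X - A) * adj (X - A) = char_poly A\<close> expresses the \<open>k\<close>-th coefficient
  through the coefficients of the adjugate; multiplied by \<open>A ^ k\<close> and summed, this telescopes.
\<close>

theorem Cayley_Hamilton:
  fixes A :: "'a :: comm_ring_1 mat"
  assumes A: "A \<in> carrier_mat n n"
  shows "poly_at_mat (char_poly A) A = 0\<^sub>m n n"
proof (rule eq_matI)
  fix i j assume "i < dim_row (0\<^sub>m n n :: 'a mat)" "j < dim_col (0\<^sub>m n n :: 'a mat)"
  then have ij: "i < n" "j < n" by auto
  let ?X = "char_poly_matrix A" and ?p = "char_poly A"
  have X: "?X \<in> carrier_mat n n" using A by simp
  define C where "C = adj_mat ?X"
  have C: "C \<in> carrier_mat n n" and XC: "?X * C = ?p \<cdot>\<^sub>m 1\<^sub>m n"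
    using adj_mat[OF X] by (auto simp: C_def char_poly_def)
  define B where "B k = mat n n (\<lambda>ij. poly.coeff (C $$ ij) k)" for k
  have B: "B k \<in> carrier_mat n n" for k by (simp add: B_def)
  \<comment> \<open>Only column \<open>j\<close> of the adjugate enters below, so the bound covers
    that column and the characteristic polynomial.\<close>
  define D where "D = Max (insert (Polynomial.degree ?p) ((\<lambda>l. Polynomial.degree (C $$ (l, j))) ` {..<n}))"
  have D: "Polynomial.degree ?p \<le> D" "l < n \<Longrightarrow> Polynomial.degree (C $$ (l, j)) \<le> D" for l
    unfolding D_def by (auto intro!: Max_ge)
  \<comment> \<open>Coefficient of \<open>X^k\<close> in entry \<open>(r, j)\<close> of the adjugate
    identity. The case \<open>k = 0\<close> is separate because a zero matrix is meant there, while
    natural subtraction would give \<open>B 0\<close>.\<close>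
  have entry: "poly.coeff ?p k * 1\<^sub>m n $$ (r, j) =
      (if k = 0 then 0 else B (k - 1) $$ (r, j)) - (A * B k) $$ (r, j)" if r: "r < n" for r k
  proof -
    have *: "?X $$ (r, l) = (if l = r then [:0, 1:] else 0) + [:- A $$ (r, l):]" if "l < n" for l
      using that r A by (auto simp: char_poly_matrix_def)
    have "?p * 1\<^sub>m n $$ (r, j) = (?X * C) $$ (r, j)"
      using r ij by (simp add: XC)
    also have "\<dots> = (\<Sum>l<n. ?X $$ (r, l) * C $$ (l, j))"
      using X C r ij by (intro index_mult_mat_sum)
    also have "\<dots> = (\<Sum>l<n. (if l = r then [:0, 1:] * C $$ (l, j) else 0)
        - Polynomial.smult (A $$ (r, l)) (C $$ (l, j)))"
      by (intro sum.cong refl) (auto simp: * distrib_right algebra_simps)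
    also have "\<dots> = pCons 0 (C $$ (r, j)) - (\<Sum>l<n. Polynomial.smult (A $$ (r, l)) (C $$ (l, j)))"
      using r by (simp add: sum_subtractf)
    finally have "poly.coeff (?p * 1\<^sub>m n $$ (r, j)) k = poly.coeff (pCons 0 (C $$ (r, j))) k
        - (\<Sum>l<n. A $$ (r, l) * poly.coeff (C $$ (l, j)) k)"
      by (simp add: coeff_sum)
    also have "(\<Sum>l<n. A $$ (r, l) * poly.coeff (C $$ (l, j)) k) = (A * B k) $$ (r, j)"
      using A r ij by (subst index_mult_mat_sum[OF A B]) (auto simp: B_def)
    also have "poly.coeff (pCons 0 (C $$ (r, j))) k = (if k = 0 then 0 else B (k - 1) $$ (r, j))"
      using r ij by (auto simp: B_def coeff_pCons split: nat.splits)
    also have "poly.coeff (?p * 1\<^sub>m n $$ (r, j)) k = poly.coeff ?p k * 1\<^sub>m n $$ (r, j)"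
      using r ij by simp
    finally show ?thesis .
  qed
  define G where "G k = (A ^\<^sub>m k * (if k = 0 then 0\<^sub>m n n else B (k - 1))) $$ (i, j)" for k
  have tele: "poly.coeff ?p k * (A ^\<^sub>m k) $$ (i, j) = G k - G (Suc k)" for k
  proof -
    have P: "A ^\<^sub>m k \<in> carrier_mat n n" using A by simp
    have "poly.coeff ?p k * (A ^\<^sub>m k) $$ (i, j) =
        (\<Sum>r<n. (A ^\<^sub>m k) $$ (i, r) * (poly.coeff ?p k * 1\<^sub>m n $$ (r, j)))"
    proof -
      have "(\<Sum>r<n. (A ^\<^sub>m k) $$ (i, r) * (poly.coeff ?p k * 1\<^sub>m n $$ (r, j))) =
          (\<Sum>r<n. if r = j then (A ^\<^sub>m k) $$ (i, r) * poly.coeff ?p k else 0)"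
        using ij by (intro sum.cong) auto
      also have "\<dots> = (A ^\<^sub>m k) $$ (i, j) * poly.coeff ?p k" using ij by simp
      finally show ?thesis by (simp add: mult.commute)
    qed
    also have "\<dots> = (\<Sum>r<n. (A ^\<^sub>m k) $$ (i, r) * (if k = 0 then 0\<^sub>m n n else B (k - 1)) $$ (r, j))
        - (\<Sum>r<n. (A ^\<^sub>m k) $$ (i, r) * (A * B k) $$ (r, j))"
      using ij unfolding sum_subtractf[symmetric]
      by (intro sum.cong refl, subst entry) (auto simp: right_diff_distrib)
    also have "(\<Sum>r<n. (A ^\<^sub>m k) $$ (i, r) * (if k = 0 then 0\<^sub>m n n else B (k - 1)) $$ (r, j)) = G k"
      using B[of "k - 1"] ij unfolding G_def by (intro index_mult_mat_sum[OF P, symmetric]) auto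
    also have "(\<Sum>r<n. (A ^\<^sub>m k) $$ (i, r) * (A * B k) $$ (r, j)) = (A ^\<^sub>m k * (A * B k)) $$ (i, j)"
      using A B[of k] ij by (intro index_mult_mat_sum[OF P, symmetric]) auto
    also have "A ^\<^sub>m k * (A * B k) = A ^\<^sub>m Suc k * B k"
      using P A B[of k] by (simp add: assoc_mult_mat[of _ n n _ n _ n])
    also have "\<dots> $$ (i, j) = G (Suc k)" by (simp add: G_def)
    finally show ?thesis .
  qed
  \<comment> \<open>The sum runs up to \<open>Suc D\<close> so that the remainder involves
    \<open>B (Suc D)\<close>, which lies above the degree bound; \<open>B D\<close> is not excluded
    by it.\<close>
  have "G (Suc (Suc D)) = 0"
  proof -
    have "B (Suc D) $$ (l, j) = 0" if "l < n" for l
      using that ij D(2)[OF that] by (simp add: B_def coeff_eq_0)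
    then show ?thesis
      using ij by (simp add: G_def index_mult_mat_sum[OF pow_carrier_mat[OF A] B]
          del: pow_mat.simps index_mult_mat)
  qed
  moreover have "G 0 = 0" using A ij by (simp add: G_def)
  moreover have "(\<Sum>k\<le>Suc D. G k - G (Suc k)) = G 0 - G (Suc (Suc D))"
    by (rule sum_telescope)
  ultimately show "poly_at_mat ?p A $$ (i, j) = 0\<^sub>m n n $$ (i, j)"
    using ij D(1) by (simp add: poly_at_mat_index[OF A ij, of _ "Suc D"] tele del: sum.atMost_Suc)
qed (use A in \<open>auto simp: poly_at_mat_def\<close>)

section \<open>Integral elements\<close>

text \<open>Taken relative to a ring map, so that it applies to the composite embedding of
  \<open>D\<close> into the algebraic closure, where \<open>integral_elem\<close> speaks of
  \<open>K\<close> only.\<close>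

definition integral_over :: "('a::comm_ring_1 \<Rightarrow> 'b::comm_ring_1) \<Rightarrow> 'b \<Rightarrow> bool" where
  "integral_over h x \<longleftrightarrow> (\<exists>p. lead_coeff p = 1 \<and> poly (map_poly h p) x = 0)"

locale ring_hom_to_field = comm_ring_hom hom for hom :: "'a::comm_ring_1 \<Rightarrow> 'b::field"
begin

text \<open>The characteristic polynomial of \<open>A\<close> is monic over the source ring, and its
  image vanishes at the eigenvalues of the image matrix.\<close>

lemma integral_over_eigenvector:
  assumes A: "A \<in> carrier_mat n n" and ev: "eigenvector (map_mat hom A) v x"
  shows "integral_over hom x"
proof -
  have "poly (map_poly hom (char_poly A)) x = 0"
    using ev A by (simp flip: char_poly_hom[OF A]
        add: eigenvalue_root_char_poly[of "map_mat hom A" n, symmetric] eigenvalue_def) auto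
  then show ?thesis
    using degree_monic_char_poly[OF A] by (auto simp: integral_over_def)
qed

section \<open>Spans over the image of the ring and the determinant trick\<close>

definition hom_span :: "'i set \<Rightarrow> ('i \<Rightarrow> 'b) \<Rightarrow> 'b set" where
  "hom_span I w = {\<Sum>j\<in>I. hom (c j) * w j | c. True}"

lemma hom_spanI: "x = (\<Sum>j\<in>I. hom (c j) * w j) \<Longrightarrow> x \<in> hom_span I w"
  by (auto simp: hom_span_def)

lemma hom_span_0 [simp]: "0 \<in> hom_span I w"
  by (rule hom_spanI[where c = "\<lambda>_. 0"]) simp

lemma hom_span_add:
  assumes "x \<in> hom_span I w" "y \<in> hom_span I w"
  shows "x + y \<in> hom_span I w"
proof -
  from assms obtain c d where "x = (\<Sum>j\<in>I. hom (c j) * w j)" "y = (\<Sum>j\<in>I. hom (d j) * w j)"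
    unfolding hom_span_def by auto
  then have "x + y = (\<Sum>j\<in>I. hom (c j + d j) * w j)"
    by (simp add: sum.distrib distrib_right hom_add)
  then show ?thesis by (rule hom_spanI)
qed

lemma hom_span_scale:
  assumes "x \<in> hom_span I w"
  shows "hom a * x \<in> hom_span I w"
proof -
  from assms obtain c where "x = (\<Sum>j\<in>I. hom (c j) * w j)"
    unfolding hom_span_def by auto
  then have "hom a * x = (\<Sum>j\<in>I. hom (a * c j) * w j)"
    by (simp add: sum_distrib_left mult.assoc hom_mult)
  then show ?thesis by (rule hom_spanI)
qed

lemma hom_span_sum: "(\<And>s. s \<in> S \<Longrightarrow> f s \<in> hom_span I w) \<Longrightarrow> sum f S \<in> hom_span I w"
  by (induction S rule: infinite_finite_induct) (auto intro: hom_span_add)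

lemma hom_span_base:
  assumes "finite I" "i \<in> I"
  shows "w i \<in> hom_span I w"
proof -
  have "w i = (\<Sum>j\<in>I. if j = i then w j else 0)"
    using assms by simp
  also have "\<dots> = (\<Sum>j\<in>I. hom (if j = i then 1 else 0) * w j)"
    by (intro sum.cong) auto
  finally show ?thesis by (rule hom_spanI)
qed

lemma mult_hom_span:
  assumes "\<And>i. i \<in> I \<Longrightarrow> x * w i \<in> hom_span I w" and "y \<in> hom_span I w"
  shows "x * y \<in> hom_span I w"
proof -
  from assms(2) obtain c where "y = (\<Sum>j\<in>I. hom (c j) * w j)"
    unfolding hom_span_def by auto
  then have "x * y = (\<Sum>j\<in>I. hom (c j) * (x * w j))"
    by (simp add: sum_distrib_left mult_ac)
  then show ?thesis using assms(1) by (auto intro!: hom_span_sum hom_span_scale)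
qed

text \<open>Determinant trick: multiplication by \<open>x\<close> on the generators has a matrix
  over the source ring, and the vector of generators is an eigenvector for \<open>x\<close>. The
  generator \<open>w i0\<close> keeps this vector from being zero.\<close>

lemma integral_over_hom_span:
  assumes "finite I" and i0: "i0 \<in> I" "w i0 \<noteq> 0"
    and x: "\<And>i. i \<in> I \<Longrightarrow> x * w i \<in> hom_span I w"
  shows "integral_over hom x"
proof -
  define N where "N = card I"
  obtain e where e: "bij_betw e {..<N} I"
    using ex_bij_betw_nat_finite[OF \<open>finite I\<close>] by (auto simp: N_def lessThan_atLeast0)
  have "\<exists>c. \<forall>i\<in>I. x * w i = (\<Sum>j\<in>I. hom (c i j) * w j)"
    using x unfolding hom_span_def by (intro bchoice) auto
  then obtain c where c: "\<And>i. i \<in> I \<Longrightarrow> x * w i = (\<Sum>j\<in>I. hom (c i j) * w j)" by blast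
  define A where "A = mat N N (\<lambda>(r, s). c (e r) (e s))"
  define v where "v = vec N (\<lambda>r. w (e r))"
  have eI: "e r \<in> I" if "r < N" for r
    using e that by (auto simp: bij_betw_def)
  have "map_mat hom A *\<^sub>v v = x \<cdot>\<^sub>v v"
  proof (rule eq_vecI)
    fix r assume "r < dim_vec (x \<cdot>\<^sub>v v)"
    then have r: "r < N" by (simp add: v_def)
    have "(map_mat hom A *\<^sub>v v) $ r = (\<Sum>s<N. hom (c (e r) (e s)) * w (e s))"
      using r by (auto simp: A_def v_def scalar_prod_def lessThan_atLeast0 intro!: sum.cong)
    also have "\<dots> = (\<Sum>j\<in>I. hom (c (e r) j) * w j)"
      by (rule sum.reindex_bij_betw[OF e])
    finally show "(map_mat hom A *\<^sub>v v) $ r = (x \<cdot>\<^sub>v v) $ r"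
      using r by (simp add: c[OF eI] v_def)
  qed (simp add: A_def v_def)
  moreover have "v \<noteq> 0\<^sub>v N"
  proof
    assume v0: "v = 0\<^sub>v N"
    from e i0(1) obtain r where r: "r < N" "e r = i0" by (auto simp: bij_betw_def)
    have "v $ r = 0" using r by (simp add: v0)
    then show False using r i0(2) by (simp add: v_def)
  qed
  ultimately have "eigenvector (map_mat hom A) v x"
    by (auto simp: eigenvector_def A_def v_def)
  then show ?thesis
    by (rule integral_over_eigenvector[of _ N, rotated]) (simp add: A_def)
qed

section \<open>Closure properties of integral elements\<close>

text \<open>The form in which an integral equation lowers exponents. Degree 0 is excluded because a
  monic constant is 1 and has no root.\<close>

lemma integral_over_power:
  assumes "integral_over hom x"
  obtains m c where "m > 0" "x ^ m = (\<Sum>l<m. hom (c l) * x ^ l)"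
proof -
  obtain p where p: "lead_coeff p = 1" "poly (map_poly hom p) x = 0"
    using assms by (auto simp: integral_over_def)
  define m where "m = Polynomial.degree p"
  have eq: "(\<Sum>l<m. hom (poly.coeff p l) * x ^ l) + x ^ m = 0"
  proof -
    have "poly (map_poly hom p) x = (\<Sum>l\<le>m. hom (poly.coeff p l) * x ^ l)"
      using eval_poly_as_sum[of hom p x] by (simp add: eval_poly_def m_def mult.commute)
    also have "\<dots> = (\<Sum>l<m. hom (poly.coeff p l) * x ^ l) + x ^ m"
      using p(1) by (simp add: m_def flip: lessThan_Suc_atMost)
    finally show ?thesis using p(2) by simp
  qed
  then have "m > 0" by (cases m) auto
  moreover have "x ^ m = (\<Sum>l<m. hom (- poly.coeff p l) * x ^ l)"
    using eq by (simp add: hom_uminus sum_negf eq_neg_iff_add_eq_0 add.commute)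
  ultimately show thesis by (rule that)
qed

text \<open>The monomials \<open>x ^ i * y ^ j\<close> below the degrees of the two integral equations span a module
  that is stable under multiplication by \<open>x\<close> and by \<open>y\<close>.\<close>

lemma integral_over_add_mult:
  assumes "integral_over hom x" "integral_over hom y"
  shows "integral_over hom (x + y)" "integral_over hom (x * y)"
proof -
  obtain m c where m: "m > 0" "x ^ m = (\<Sum>l<m. hom (c l) * x ^ l)"
    using assms(1) by (rule integral_over_power)
  obtain k d where k: "k > 0" "y ^ k = (\<Sum>l<k. hom (d l) * y ^ l)"
    using assms(2) by (rule integral_over_power)
  define I where "I = {..<m} \<times> {..<k}"
  define w where "w = (\<lambda>(i, j). x ^ i * y ^ j)"
  have fin: "finite I" by (simp add: I_def)
  have base: "x ^ i * y ^ j \<in> hom_span I w" if "i < m" "j < k" for i j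
    using hom_span_base[OF fin, of "(i, j)" w] that by (simp add: I_def w_def)
  have x: "x * w i \<in> hom_span I w" if "i \<in> I" for i
  proof -
    from that obtain i1 i2 where i: "i = (i1, i2)" "i1 < m" "i2 < k" by (auto simp: I_def)
    show ?thesis
    proof (cases "Suc i1 < m")
      case True
      then show ?thesis using base[of "Suc i1" i2] i by (simp add: w_def mult.assoc)
    next
      \<comment> \<open>At the top exponent the integral equation of \<open>x\<close> rewrites
        \<open>x ^ m\<close> through lower powers.\<close>
      case False
      then have "Suc i1 = m" using i by simp
      then have "x * w i = x ^ m * y ^ i2" using i by (auto simp: w_def mult.assoc)
      also have "\<dots> = (\<Sum>l<m. hom (c l) * (x ^ l * y ^ i2))"
        by (simp add: m(2) sum_distrib_right mult.assoc)
      finally show ?thesis using i base by (auto intro!: hom_span_sum hom_span_scale)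
    qed
  qed
  have y: "y * w i \<in> hom_span I w" if "i \<in> I" for i
  proof -
    from that obtain i1 i2 where i: "i = (i1, i2)" "i1 < m" "i2 < k" by (auto simp: I_def)
    show ?thesis
    proof (cases "Suc i2 < k")
      case True
      then show ?thesis using base[of i1 "Suc i2"] i by (simp add: w_def mult.left_commute)
    next
      case False
      then have "Suc i2 = k" using i by simp
      then have "y * w i = x ^ i1 * y ^ k" using i by (auto simp: w_def mult_ac)
      also have "\<dots> = (\<Sum>l<k. hom (d l) * (x ^ i1 * y ^ l))"
        by (simp add: k(2) sum_distrib_left mult_ac)
      finally show ?thesis using i base by (auto intro!: hom_span_sum hom_span_scale)
    qed
  qed
  \<comment> \<open>The monomial 1 is the nonzero generator; it belongs to the family because both
    degrees are positive.\<close>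
  have "(0, 0) \<in> I" "w (0, 0) \<noteq> 0" using m(1) k(1) by (auto simp: I_def w_def)
  note span = integral_over_hom_span[where w = w, OF fin this]
  show "integral_over hom (x + y)"
    using x y by (intro span) (auto simp: distrib_right intro: hom_span_add)
  \<comment> \<open>\<open>y\<close> sends each generator into the span, and \<open>x\<close>
    preserves the span.\<close>
  show "integral_over hom (x * y)"
    using x y by (intro span) (auto simp: mult.assoc intro: mult_hom_span)
qed

lemma integral_over_hom [simp]: "integral_over hom (hom a)"
  unfolding integral_over_def
  by (intro exI[of _ "[:- a, 1:]"]) (simp add: map_poly_pCons_hom hom_uminus)

lemma integral_over_0 [simp]: "integral_over hom 0"
  using integral_over_hom[of 0] by simp

lemma integral_over_uminus: "integral_over hom x \<Longrightarrow> integral_over hom (- x)"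
  using integral_over_add_mult(2)[OF integral_over_hom[of "- 1"], of x] by (simp add: hom_uminus)

text \<open>Multiplication by \<open>X - a\<close> forms new coefficients from old ones by sums and
  products with \<open>a\<close>, so induction over the roots avoids explicit symmetric
  functions.\<close>

lemma integral_over_coeff_prod_mset:
  assumes "\<And>x. x \<in># A \<Longrightarrow> integral_over hom x"
  shows "integral_over hom (poly.coeff (\<Prod>x\<in>#A. [:- x, 1:]) k)"
  using assms
proof (induction A arbitrary: k)
  case empty
  then show ?case using integral_over_hom[of 1] by (simp add: Polynomial.coeff_1)
next
  case (add a A)
  let ?q = "\<Prod>x\<in>#A. [:- x, 1:]"
  have q: "integral_over hom (poly.coeff ?q i)" for i
    using add by auto
  have "[:- a, 1:] * ?q = Polynomial.smult (- a) ?q + pCons 0 ?q" by simp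
  moreover have "integral_over hom (poly.coeff (pCons 0 ?q) k)"
    using q by (cases k) auto
  ultimately show ?case
    using integral_over_add_mult(1)[OF integral_over_uminus[OF integral_over_add_mult(2)[OF _ q]]] add.prems
    by (simp del: mult_pCons_left)
qed

end

section \<open>Integral matrices and polynomial density\<close>

interpretation to_fract_hom: inj_comm_ring_hom to_fract
  by unfold_locales auto

interpretation to_ac_hom: inj_comm_ring_hom to_ac
  by unfold_locales auto

interpretation to_closure_hom: ring_hom_to_field "\<lambda>c. to_ac (to_fract c)"
  by unfold_locales auto

abbreviation integral_ac :: "'d::idom fract alg_closure \<Rightarrow> bool" where
  "integral_ac \<equiv> integral_over (\<lambda>c. to_ac (to_fract c))"

lemma map_poly_to_ac_to_fract:
  "map_poly to_ac (map_poly to_fract p) = map_poly (\<lambda>c. to_ac (to_fract c)) p"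
  by (simp add: map_poly_map_poly o_def)

text \<open>\<open>to_ac\<close> is injective, so a polynomial over \<open>D\<close> vanishes at
  \<open>x\<close> exactly when it vanishes at the image of \<open>x\<close>.\<close>

lemma integral_elem_iff: "integral_elem x \<longleftrightarrow> integral_ac (to_ac x)"
  unfolding integral_elem_def integral_over_def
  by (simp flip: map_poly_to_ac_to_fract)

lemma eigenvalues_ac_iff:
  "\<alpha> \<in> eigenvalues_ac M \<longleftrightarrow> eigenvalue (map_mat to_ac M) \<alpha>"
  by (simp add: eigenvalues_ac_def spectrum_def)

lemma eigenvalues_ac_char_poly:
  assumes "M \<in> carrier_mat n n"
  shows "eigenvalues_ac M = {\<alpha>. poly (map_poly to_ac (char_poly M)) \<alpha> = 0}"
  using assms
  by (simp add: eigenvalues_ac_def spectrum_root_char_poly[of _ n] to_ac_hom.char_poly_hom[OF assms])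

lemma monic_factorization:
  fixes p :: "'a :: alg_closed_field poly"
  assumes "lead_coeff p = 1"
  obtains A where "size A = Polynomial.degree p" "p = (\<Prod>x\<in>#A. [:- x, 1:])"
    "\<forall>x\<in>#A. poly p x = 0"
proof -
  have "p \<noteq> 0" using assms by auto
  from alg_closed_imp_factorization[OF this] obtain A
    where A: "size A = Polynomial.degree p" "p = (\<Prod>x\<in>#A. [:- x, 1:])"
    using assms by auto
  have "poly p x = 0" if x: "x \<in># A" for x
  proof -
    from multi_member_split[OF x] obtain B where "A = add_mset x B" by blast
    then show ?thesis by (simp add: A(2))
  qed
  with A show thesis by (intro that) auto
qed

section \<open>Characteristic polynomials and eigenvalues of integral matrices\<close>

lemma char_poly_integral:
  fixes M :: "'d::idom fract mat"
  assumes D: "integrally_closed TYPE('d)" and M: "M \<in> carrier_mat n n"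
    and ev: "\<And>\<alpha>. \<alpha> \<in> eigenvalues_ac M \<Longrightarrow> integral_ac \<alpha>"
  obtains p :: "'d poly" where "lead_coeff p = 1" "Polynomial.degree p = n" "map_poly to_fract p = char_poly M"
proof -
  let ?c = "char_poly M"
  have c: "Polynomial.degree ?c = n" "poly.coeff ?c n = 1"
    using degree_monic_char_poly[OF M] by auto
  then have "lead_coeff (map_poly to_ac ?c) = 1" by (simp add: degree_map_poly)
  then obtain A where A: "size A = Polynomial.degree (map_poly to_ac ?c)"
    "map_poly to_ac ?c = (\<Prod>x\<in>#A. [:- x, 1:])"
    "\<forall>x\<in>#A. poly (map_poly to_ac ?c) x = 0"
    by (rule monic_factorization)
  have "integral_ac (to_ac (poly.coeff ?c k))" for k
    using to_closure_hom.integral_over_coeff_prod_mset[of A k] A(3) ev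
    unfolding A(2)[symmetric] by (simp add: eigenvalues_ac_char_poly[OF M])
  then have "\<exists>d. poly.coeff ?c k = to_fract d" for k
    using D by (auto simp: integrally_closed_def integral_elem_iff)
  then obtain d where d: "\<And>k. poly.coeff ?c k = to_fract (d k)" by metis
  \<comment> \<open>\<open>d\<close> is chosen for all \<open>k\<close>; truncation at
    \<open>n\<close> loses nothing, since the coefficients of \<open>?c\<close> vanish beyond
    \<open>n\<close>.\<close>
  define p where "p = (\<Sum>k\<le>n. Polynomial.monom (d k) k)"
  have "poly.coeff p k = (if k \<le> n then d k else 0)" for k
    by (simp add: p_def coeff_sum)
  moreover have "to_fract (d k) = 0" if "k > n" for k
    using that c(1) by (simp flip: d add: coeff_eq_0)
  ultimately have p: "map_poly to_fract p = ?c"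
    by (intro poly_eqI) (auto simp: d not_le)
  then have "Polynomial.degree p = n" using c(1) by (simp flip: p add: degree_map_poly)
  moreover have "to_fract (poly.coeff p n) = 1" using c(2) by (simp flip: p)
  then have "poly.coeff p n = 1" using to_fract_eq_iff[of "poly.coeff p n" 1] by simp
  ultimately show thesis using p by (intro that) auto
qed

text \<open>A monic polynomial over \<open>D\<close> annihilating \<open>M\<close> also annihilates
  its image over the closure, hence vanishes at each eigenvalue.\<close>

lemma eigenvalue_of_integral_mat:
  assumes "M \<in> integral_mats n" and "\<alpha> \<in> eigenvalues_ac M"
  shows "integral_ac \<alpha>"
proof -
  obtain p where M: "M \<in> carrier_mat n n" and p: "lead_coeff p = 1"
    "poly_at_mat (map_poly to_fract p) M = 0\<^sub>m n n"
    using assms(1) by (auto simp: integral_mats_def)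
  obtain v where v: "eigenvector (map_mat to_ac M) v \<alpha>"
    using assms(2) by (auto simp: eigenvalues_ac_iff eigenvalue_def)
  have "poly_at_mat (map_poly to_ac (map_poly to_fract p)) (map_mat to_ac M) = 0\<^sub>m n n"
    by (simp flip: to_ac_hom.poly_at_mat_hom[OF M] add: p(2)) auto
  then have "poly (map_poly to_ac (map_poly to_fract p)) \<alpha> = 0"
    by (rule poly_at_mat_0_eigenvector[OF _ v, rotated]) (use M in simp)
  then show ?thesis
    using p(1) by (auto simp: integral_over_def map_poly_to_ac_to_fract)
qed

lemma eigenvalues_ac_poly_at_mat:
  assumes M: "M \<in> carrier_mat n n" and "\<alpha> \<in> eigenvalues_ac M"
  shows "poly (map_poly to_ac f) \<alpha> \<in> eigenvalues_ac (poly_at_mat f M)"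
proof -
  obtain v where v: "eigenvector (map_mat to_ac M) v \<alpha>"
    using assms(2) by (auto simp: eigenvalues_ac_iff eigenvalue_def)
  have "eigenvector (map_mat to_ac (poly_at_mat f M)) v (poly (map_poly to_ac f) \<alpha>)"
    unfolding to_ac_hom.poly_at_mat_hom[OF M]
    by (rule eigenvector_poly_at_mat'[OF _ v]) (use M in simp)
  then show ?thesis
    using M by (auto simp: eigenvalues_ac_iff eigenvalue_def)
qed

text \<open>
  If a monic \<open>g\<close> over \<open>D\<close> vanishes at \<open>f \<alpha>\<close> for all eigenvalues \<open>\<alpha>\<close> of \<open>M\<close>, then the characteristic
  polynomial, a product of \<open>n\<close> factors \<open>X - \<alpha>\<close>, divides \<open>g ^ n \<circ> f\<close>; so \<open>g ^ n\<close> annihilates \<open>f(M)\<close>.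
\<close>

lemma integral_poly_at_mat_iff:
  fixes M :: "'d::idom fract mat"
  assumes M: "M \<in> carrier_mat n n"
  shows "poly_at_mat f M \<in> integral_mats n \<longleftrightarrow>
    (\<forall>\<alpha>\<in>eigenvalues_ac M. integral_ac (poly (map_poly to_ac f) \<alpha>))"
proof
  assume "poly_at_mat f M \<in> integral_mats n"
  then show "\<forall>\<alpha>\<in>eigenvalues_ac M. integral_ac (poly (map_poly to_ac f) \<alpha>)"
    using eigenvalue_of_integral_mat eigenvalues_ac_poly_at_mat[OF M] by blast
next
  assume *: "\<forall>\<alpha>\<in>eigenvalues_ac M. integral_ac (poly (map_poly to_ac f) \<alpha>)"
  let ?F = "map_poly to_ac f" and ?M = "map_mat to_ac M"
  let ?h = "map_poly (\<lambda>c::'d. to_ac (to_fract c))"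
  interpret P: map_poly_comm_ring_hom "\<lambda>c::'d. to_ac (to_fract c)" ..
  have M': "?M \<in> carrier_mat n n" using M by simp
  obtain P where P: "\<And>\<alpha>. \<alpha> \<in> eigenvalues_ac M \<Longrightarrow> lead_coeff (P \<alpha>) = 1 \<and> poly (?h (P \<alpha>)) (poly ?F \<alpha>) = 0"
    using * unfolding integral_over_def by metis
  have fin: "finite (eigenvalues_ac M)"
    unfolding eigenvalues_ac_def by (rule card_finite_spectrum[OF M'])
  \<comment> \<open>One monic polynomial for all eigenvalues at once: at each
    \<open>f(\<alpha>)\<close> the factor \<open>P \<alpha>\<close> vanishes.\<close>
  define g where "g = (\<Prod>\<alpha>\<in>eigenvalues_ac M. P \<alpha>)"
  have "lead_coeff g = 1"
    unfolding g_def lead_coeff_prod using P by (intro prod.neutral) auto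
  then have g: "lead_coeff (g ^ n) = 1" by (simp add: lead_coeff_power)
  have root: "poly (?h g) (poly ?F \<alpha>) = 0" if "\<alpha> \<in> eigenvalues_ac M" for \<alpha>
    using that fin P by (auto simp: g_def P.hom_prod poly_prod)
  have "lead_coeff (char_poly ?M) = 1" using degree_monic_char_poly[OF M'] by auto
  then obtain A where A: "size A = Polynomial.degree (char_poly ?M)"
    "char_poly ?M = (\<Prod>x\<in>#A. [:- x, 1:])" "\<forall>x\<in>#A. poly (char_poly ?M) x = 0"
    by (rule monic_factorization)
  \<comment> \<open>Roots are counted with multiplicity, and each factor \<open>X - x\<close> uses
    up one copy of \<open>g o f\<close>; hence the power.\<close>
  have "(\<Prod>x\<in>#A. [:- x, 1:]) dvd pcompose (?h g) ?F ^ size A"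
    using A(3)
  proof (induction A)
    case (add x A)
    have "x \<in> eigenvalues_ac M"
      using add.prems by (simp add: eigenvalues_ac_def spectrum_root_char_poly[OF M'])
    then have "[:- x, 1:] dvd pcompose (?h g) ?F"
      using root by (simp add: poly_eq_0_iff_dvd[symmetric] poly_pcompose)
    with add have "[:- x, 1:] * (\<Prod>x\<in>#A. [:- x, 1:]) dvd
        pcompose (?h g) ?F * pcompose (?h g) ?F ^ size A"
      by (intro mult_dvd_mono) auto
    then show ?case by simp
  qed simp
  then have "char_poly ?M dvd pcompose (?h (g ^ n)) ?F"
    using A(1) degree_monic_char_poly[OF M']
    by (simp add: P.hom_power pcompose_hom.hom_power flip: A(2))
  then have "poly_at_mat (pcompose (?h (g ^ n)) ?F) ?M = 0\<^sub>m n n"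
    by (rule poly_at_mat_dvd_eq_0[OF M' Cayley_Hamilton[OF M']])
  then have "map_mat to_ac (poly_at_mat (map_poly to_fract (g ^ n)) (poly_at_mat f M)) = 0\<^sub>m n n"
    by (simp add: poly_at_mat_pcompose[OF M'] to_ac_hom.poly_at_mat_hom[OF M]
      to_ac_hom.poly_at_mat_hom[OF poly_at_mat_carrier[OF M]] map_poly_to_ac_to_fract)
  also have "0\<^sub>m n n = map_mat to_ac (0\<^sub>m n n :: 'd fract mat)" by auto
  finally have "poly_at_mat (map_poly to_fract (g ^ n)) (poly_at_mat f M) = 0\<^sub>m n n"
    by (rule to_ac_hom.mat_hom_inj)
  then show "poly_at_mat f M \<in> integral_mats n"
    using g M unfolding integral_mats_def by auto
qed

section \<open>The density criterion\<close>

text \<open>Integrality of \<open>f(N)\<close> constrains \<open>f\<close> exactly at the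
  eigenvalues of \<open>N\<close>, so a spectrum containing that of \<open>M\<close> forces
  \<open>f(M)\<close> to be integral.\<close>

lemma polynomially_denseI:
  assumes S: "S \<subseteq> integral_mats n"
    and ev: "\<And>M. M \<in> integral_mats n \<Longrightarrow> \<exists>N\<in>S. eigenvalues_ac M \<subseteq> eigenvalues_ac N"
  shows "polynomially_dense S (integral_mats n)"
proof -
  have "poly_at_mat f M \<in> integral_mats n"
    if f: "f \<in> Int_K S (integral_mats n)" and M: "M \<in> integral_mats n" for f M
  proof -
    obtain N where N: "N \<in> S" "eigenvalues_ac M \<subseteq> eigenvalues_ac N" using ev[OF M] by blast
    have "M \<in> carrier_mat n n" "N \<in> carrier_mat n n"
      using M N(1) S by (auto simp: integral_mats_def)
    moreover have "poly_at_mat f N \<in> integral_mats n" using f N(1) by (auto simp: Int_K_def)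
    ultimately show ?thesis using N(2) by (auto simp: integral_poly_at_mat_iff)
  qed
  then show ?thesis using S by (auto simp: polynomially_dense_def Int_K_def)
qed

lemma integral_matsI_char_poly:
  assumes "M \<in> carrier_mat n n" "lead_coeff p = 1" "map_poly to_fract p = char_poly M"
  shows "M \<in> integral_mats n"
  using assms Cayley_Hamilton[OF assms(1)] by (auto simp: integral_mats_def)

section \<open>Companion matrices\<close>

lemma companion_mat_carrier: "companion_mat p \<in> carrier_mat (Polynomial.degree p) (Polynomial.degree p)"
  by (simp add: companion_mat_def Let_def)

text \<open>The witness is the characteristic polynomial of the companion matrix, which is monic
  over \<open>D\<close> because the matrix has entries in \<open>D\<close>.\<close>

lemma companion_mats_subset: "(companion_mats n :: 'd::idom fract mat set) \<subseteq> integral_mats n"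
proof
  fix M :: "'d fract mat" assume "M \<in> companion_mats n"
  then obtain p :: "'d poly" where p: "M = map_mat to_fract (companion_mat p)" "Polynomial.degree p = n"
    by (auto simp: companion_mats_def)
  have C: "companion_mat p \<in> carrier_mat n n" using companion_mat_carrier[of p] p(2) by simp
  show "M \<in> integral_mats n"
    unfolding p(1)
  proof (rule integral_matsI_char_poly)
    show "lead_coeff (char_poly (companion_mat p)) = 1"
      using degree_monic_char_poly[OF C] by simp
  qed (use C in \<open>simp_all add: to_fract_hom.char_poly_hom[OF C]\<close>)
qed

text \<open>The powers of a root of \<open>p\<close> form an eigenvector of the transposed companion matrix.\<close>

lemma root_eigenvalue_companion_mat:
  fixes h :: "'a::comm_ring_1 \<Rightarrow> 'b::field"
  assumes "comm_ring_hom h" and p: "lead_coeff p = 1" "Polynomial.degree p = n" "n \<ge> 1"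
    and root: "poly (map_poly h p) x = 0"
  shows "eigenvalue (map_mat h (companion_mat p)) x"
proof -
  interpret comm_ring_hom h by fact
  let ?C = "map_mat h (companion_mat p)"
  have C: "?C \<in> carrier_mat n n" using companion_mat_carrier[of p] p(2) by simp
  define v where "v = vec n (\<lambda>i. x ^ i)"
  have pow: "x ^ n = (\<Sum>i<n. h (- poly.coeff p i) * x ^ i)"
  proof -
    have "poly (map_poly h p) x = (\<Sum>i\<le>n. h (poly.coeff p i) * x ^ i)"
      using eval_poly_as_sum[of h p x] p(2) by (simp add: eval_poly_def mult.commute)
    also have "\<dots> = (\<Sum>i<n. h (poly.coeff p i) * x ^ i) + x ^ n"
      using p by (simp flip: lessThan_Suc_atMost)
    finally show ?thesis
      using root by (simp add: hom_uminus sum_negf eq_neg_iff_add_eq_0 add.commute)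
  qed
  have "transpose_mat ?C *\<^sub>v v = x \<cdot>\<^sub>v v"
  proof (rule eq_vecI)
    fix j assume "j < dim_vec (x \<cdot>\<^sub>v v)"
    then have j: "j < n" by (simp add: v_def)
    have "(transpose_mat ?C *\<^sub>v v) $ j = (\<Sum>i<n. ?C $$ (i, j) * x ^ i)"
      using C j by (auto simp: v_def scalar_prod_def lessThan_atLeast0 intro!: sum.cong)
    \<comment> \<open>The last column encodes the equation \<open>p(x) = 0\<close>; every other
      column shifts the exponent by one.\<close>
    also have "\<dots> = x ^ Suc j"
    proof (cases "j = n - 1")
      case True
      then have "(\<Sum>i<n. ?C $$ (i, j) * x ^ i) = (\<Sum>i<n. h (- poly.coeff p i) * x ^ i)"
        using j p(2) by (intro sum.cong) (auto simp: companion_mat_def Let_def)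
      with True show ?thesis using j by (simp add: pow[symmetric] del: power_Suc)
    next
      case False
      then have "(\<Sum>i<n. ?C $$ (i, j) * x ^ i) = (\<Sum>i<n. if i = Suc j then x ^ i else 0)"
        using j p(2) by (intro sum.cong) (auto simp: companion_mat_def Let_def)
      then show ?thesis using False j by (simp del: power_Suc)
    qed
    finally show "(transpose_mat ?C *\<^sub>v v) $ j = (x \<cdot>\<^sub>v v) $ j" using j by (simp add: v_def)
  qed (use C in \<open>simp add: v_def\<close>)
  moreover have "v $ 0 \<noteq> 0\<^sub>v n $ 0" using p(3) by (simp add: v_def)
  then have "v \<noteq> 0\<^sub>v n" by metis
  ultimately have "eigenvalue (transpose_mat ?C) x"
    unfolding eigenvalue_def eigenvector_def using C by (intro exI[of _ v]) (auto simp: v_def)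
  \<comment> \<open>A matrix and its transpose have the same characteristic polynomial.\<close>
  then show ?thesis
    using C by (simp add: eigenvalue_root_char_poly[of _ n])
qed

theorem proposition4p2:
  fixes n :: nat
  assumes "integrally_closed TYPE('d::idom)"
    and "n \<ge> 1"
  shows "(\<forall>C :: 'd fract alg_closure set \<Rightarrow> 'd fract mat.
            (\<forall>\<Omega>\<in>realizable_spectra n. C \<Omega> \<in> integral_mats n \<and> eigenvalues_ac (C \<Omega>) = \<Omega>) \<longrightarrow>
            polynomially_dense (C ` realizable_spectra n) (integral_mats n)) \<and>
         polynomially_dense (companion_mats n :: 'd fract mat set) (integral_mats n)"
proof -
  \<comment> \<open>Serves both claims: a spectrum of this form lies in
    \<open>integral_roots n\<close>, and the same \<open>p\<close> supplies the companion
    matrix.\<close>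
  have char_poly: "\<exists>p :: 'd poly. lead_coeff p = 1 \<and> Polynomial.degree p = n \<and>
      eigenvalues_ac M = {\<alpha>. poly (map_poly (\<lambda>c. to_ac (to_fract c)) p) \<alpha> = 0}"
    if M: "M \<in> integral_mats n" for M :: "'d fract mat"
  proof -
    have carrier: "M \<in> carrier_mat n n" using M by (simp add: integral_mats_def)
    obtain p :: "'d poly" where "lead_coeff p = 1" "Polynomial.degree p = n"
      "map_poly to_fract p = char_poly M"
      using char_poly_integral[OF assms(1) carrier eigenvalue_of_integral_mat[OF M]] by blast
    then show ?thesis
      by (auto simp: eigenvalues_ac_char_poly[OF carrier] simp flip: map_poly_to_ac_to_fract)
  qed
  have realizable: "eigenvalues_ac M \<in> realizable_spectra n"
    if M: "M \<in> integral_mats n" for M :: "'d fract mat"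
  proof -
    have "map_mat to_ac M \<in> carrier_mat n n" using M by (simp add: integral_mats_def)
    then have "finite (eigenvalues_ac M)" "card (eigenvalues_ac M) \<le> n"
      unfolding eigenvalues_ac_def by (rule card_finite_spectrum)+
    moreover have "eigenvalues_ac M \<subseteq> integral_roots n"
      using char_poly[OF M] by (auto simp: integral_roots_def)
    ultimately show ?thesis using M by (auto simp: realizable_spectra_def)
  qed
  \<comment> \<open>For given \<open>M\<close> the criterion is met by
    \<open>C (eigenvalues_ac M)\<close>, whose spectrum equals that of \<open>M\<close>.\<close>
  have "polynomially_dense (C ` realizable_spectra n) (integral_mats n)"
    if "\<forall>\<Omega>\<in>realizable_spectra n. C \<Omega> \<in> integral_mats n \<and> eigenvalues_ac (C \<Omega>) = \<Omega>"
    for C :: "'d fract alg_closure set \<Rightarrow> 'd fract mat"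
    using that realizable by (intro polynomially_denseI) blast+
  moreover have "polynomially_dense (companion_mats n :: 'd fract mat set) (integral_mats n)"
  proof (rule polynomially_denseI[OF companion_mats_subset])
    fix M :: "'d fract mat" assume M: "M \<in> integral_mats n"
    obtain p :: "'d poly" where p: "lead_coeff p = 1" "Polynomial.degree p = n"
      "eigenvalues_ac M = {\<alpha>. poly (map_poly (\<lambda>c. to_ac (to_fract c)) p) \<alpha> = 0}"
      using char_poly[OF M] by blast
    let ?N = "map_mat to_fract (companion_mat p)"
    have "map_mat to_ac ?N = map_mat (\<lambda>c. to_ac (to_fract c)) (companion_mat p)"
      by (rule eq_matI) auto
    then have "eigenvalues_ac M \<subseteq> eigenvalues_ac ?N"
      unfolding p(3) eigenvalues_ac_def[of ?N] spectrum_def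
      using root_eigenvalue_companion_mat[OF to_closure_hom.comm_ring_hom_axioms p(1,2) assms(2)]
      by auto
    moreover have "?N \<in> companion_mats n" using p by (auto simp: companion_mats_def)
    ultimately show "\<exists>N\<in>companion_mats n. eigenvalues_ac M \<subseteq> eigenvalues_ac N" by blast
  qed
  ultimately show ?thesis by blast
qed

end
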